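(* Let $Z$ be a central ideal of a diassociative algebra $L$ over a field $\mathbb{F}$. The sequence $$\mathcal{H}^2(L/Z,\mathbb{F})\xrightarrow{\mathrm{Inf}}\mathcal{H}^2(L,\mathbb{F})\xrightarrow{\delta}\bigl(\mathrm{Bil}(L/L'\times Z,\mathbb{F})\oplus\mathrm{Bil}(Z\times L/L',\mathbb{F})\bigr)^2$$ is exact.
   Context: A diassociative algebra over a field $\mathbb{F}$ is an $\mathbb{F}$-vector space with two associative bilinear products $\dashv,\vdash$ satisfying $x\dashv(y\dashv z)=x\dashv(y\vdash z)$, $(x\vdash y)\dashv z=x\vdash(y\dashv z)$, $(x\dashv y)\vdash z=(x\vdash y)\vdash z$. $L'$ is the span of all products $x\dashv y$, $x\vdash y$ in $L$; $Z(L)$ is the set of $z\in L$ with $z\dashv x=x\dashv z=z\vdash x=x\vdash z=0$ for all $x\in L$; a central ideal is an ideal contained in $Z(L)$. $\mathrm{Bil}(U\times V,\mathbb{F})$ is the space of bilinear forms $U\times V\to\mathbb{F}$. For a diassociative algebra $B$, $\mathcal{Z}^2(B,\mathbb{F})$ is the space of pairs $(f_\dashv,f_\vdash)$ of bilinear forms $B\times B\to\mathbb{F}$ such that for all $i,j,k\in B$: $f_\dashv(i,j\dashv k)=f_\dashv(i,j\vdash k)$; $f_\dashv(i\vdash j,k)=f_\vdash(i,j\dashv k)$; $f_\vdash(i\dashv j,k)=f_\vdash(i\vdash j,k)$; $f_\dashv(i,j\dashv k)=f_\dashv(i\dashv j,k)$; $f_\vdash(i,j\vdash k)=f_\vdash(i\vdash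 j,k)$. $\mathcal{B}^2(B,\mathbb{F})$ is the subspace of pairs $f_\dashv(i,j)=-\varepsilon(i\dashv j)$, $f_\vdash(i,j)=-\varepsilon(i\vdash j)$ with $\varepsilon:B\to\mathbb{F}$ linear. $\mathcal{H}^2(B,\mathbb{F})=\mathcal{Z}^2(B,\mathbb{F})/\mathcal{B}^2(B,\mathbb{F})$. $\mathrm{Inf}$ sends the class of $(f_\dashv,f_\vdash)$ to the class of $(f'_\dashv,f'_\vdash)$ with $f'_\dashv(x,y)=f_\dashv(x+Z,y+Z)$, $f'_\vdash(x,y)=f_\vdash(x+Z,y+Z)$. $\delta$ sends the class of $(f'_\dashv,f'_\vdash)\in\mathcal{Z}^2(L,\mathbb{F})$ to $(f''_\dashv,g''_\dashv,f''_\vdash,g''_\vdash)$, where for $x\in L$, $z\in Z$: $f''_\dashv(x+L',z)=f'_\dashv(x,z)$, $f''_\vdash(x+L',z)=f'_\vdash(x,z)$, $g''_\dashv(z,x+L')=f'_\dashv(z,x)$, $g''_\vdash(z,x+L')=f'_\vdash(z,x)$ (these are well defined). *)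

theory Defs
  imports "Jordan_Normal_Form.Missing_VectorSpace" "HOL-Algebra.AbelCoset"
begin

section \<open>Vector spaces\<close>

text \<open>
  The record \<^typ>\<open>('a, 'b) module\<close> carries two ring fields \<^const>\<open>mult\<close> and \<^const>\<open>one\<close> that
  play no role for vector spaces.
\<close>

definition quot_space :: "('a, 'b, 'm) module_scheme \<Rightarrow> 'b set \<Rightarrow> ('a, 'b set) module"
  where "quot_space M N =
    \<lparr>carrier = a_rcosets\<^bsub>M\<^esub> N,
     mult = undefined,
     one = undefined,
     zero = N,
     add = (\<lambda>X Y. X <+>\<^bsub>M\<^esub> Y),
     smult = (\<lambda>a X. \<Union>x\<in>X. N +>\<^bsub>M\<^esub> (a \<odot>\<^bsub>M\<^esub> x))\<rparr>"

definition linear_forms :: "('a, 'c) ring_scheme \<Rightarrow> ('a, 'b, 'm) module_scheme \<Rightarrow> ('b \<Rightarrow> 'a) set"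
  where "linear_forms F V =
    {e \<in> carrier V \<rightarrow> carrier F.
       (\<forall>x\<in>carrier V. \<forall>y\<in>carrier V. e (x \<oplus>\<^bsub>V\<^esub> y) = e x \<oplus>\<^bsub>F\<^esub> e y) \<and>
       (\<forall>a\<in>carrier F. \<forall>x\<in>carrier V. e (a \<odot>\<^bsub>V\<^esub> x) = a \<otimes>\<^bsub>F\<^esub> e x)}"

text \<open>
  Forms are extensional functions on the product of the carriers, so that equality of forms is
  equality of HOL functions; the operations are the pointwise ones of \<^const>\<open>ring.func_space\<close>.
\<close>

definition Bil :: "('a, 'c) ring_scheme \<Rightarrow> ('a, 'u, 'm) module_scheme \<Rightarrow> ('a, 'v, 'n) module_scheme
    \<Rightarrow> ('a, 'u \<times> 'v \<Rightarrow> 'a) module"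
  where "Bil F U V = (ring.func_space F (carrier U \<times> carrier V))
    \<lparr>carrier := {f \<in> carrier U \<times> carrier V \<rightarrow>\<^sub>E carrier F.
       (\<forall>v\<in>carrier V. (\<lambda>u. f (u, v)) \<in> linear_forms F U) \<and>
       (\<forall>u\<in>carrier U. (\<lambda>v. f (u, v)) \<in> linear_forms F V)}\<rparr>"

text \<open>Exactness at \<open>B\<close> of a sequence \<open>A \<rightarrow> B \<rightarrow> C\<close> of vector spaces and linear maps.\<close>

definition exact_sequence :: "('a, 'c) ring_scheme \<Rightarrow> ('a, 'u, 'k) module_scheme \<Rightarrow> ('u \<Rightarrow> 'v)
    \<Rightarrow> ('a, 'v, 'm) module_scheme \<Rightarrow> ('v \<Rightarrow> 'w) \<Rightarrow> ('a, 'w, 'n) module_scheme \<Rightarrow> bool"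
  where "exact_sequence F A f B g C \<longleftrightarrow>
    linear_map F A B f \<and> linear_map F B C g \<and> mod_hom.im A f = mod_hom.ker B C g"

section \<open>Diassociative algebras\<close>

record ('a, 'b) dialgebra = "('a, 'b) module" +
  lprod :: "['b, 'b] \<Rightarrow> 'b" (infixl \<open>\<stileturn>\<index>\<close> 70)
  rprod :: "['b, 'b] \<Rightarrow> 'b" (infixl \<open>\<turnstile>\<index>\<close> 70)

locale diassociative_algebra = vectorspace F L
  for F :: "('a, 'c) ring_scheme" and L :: "('a, 'b, 'd) dialgebra_scheme" (structure) +
  assumes lprod_linear_left: "y \<in> carrier L \<Longrightarrow> (\<lambda>x. x \<stileturn> y) \<in> module_hom F L L"
    and lprod_linear_right: "x \<in> carrier L \<Longrightarrow> (\<lambda>y. x \<stileturn> y) \<in> module_hom F L L"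
    and rprod_linear_left: "y \<in> carrier L \<Longrightarrow> (\<lambda>x. x \<turnstile> y) \<in> module_hom F L L"
    and rprod_linear_right: "x \<in> carrier L \<Longrightarrow> (\<lambda>y. x \<turnstile> y) \<in> module_hom F L L"
    and lprod_assoc:
      "\<lbrakk>x \<in> carrier L; y \<in> carrier L; z \<in> carrier L\<rbrakk> \<Longrightarrow> (x \<stileturn> y) \<stileturn> z = x \<stileturn> (y \<stileturn> z)"
    and rprod_assoc:
      "\<lbrakk>x \<in> carrier L; y \<in> carrier L; z \<in> carrier L\<rbrakk> \<Longrightarrow> (x \<turnstile> y) \<turnstile> z = x \<turnstile> (y \<turnstile> z)"
    and lprod_lprod_eq_lprod_rprod:
      "\<lbrakk>x \<in> carrier L; y \<in> carrier L; z \<in> carrier L\<rbrakk> \<Longrightarrow> x \<stileturn> (y \<stileturn> z) = x \<stileturn> (y \<turnstile> z)"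
    and rprod_lprod_assoc:
      "\<lbrakk>x \<in> carrier L; y \<in> carrier L; z \<in> carrier L\<rbrakk> \<Longrightarrow> (x \<turnstile> y) \<stileturn> z = x \<turnstile> (y \<stileturn> z)"
    and lprod_rprod_eq_rprod_rprod:
      "\<lbrakk>x \<in> carrier L; y \<in> carrier L; z \<in> carrier L\<rbrakk> \<Longrightarrow> (x \<stileturn> y) \<turnstile> z = (x \<turnstile> y) \<turnstile> z"

text \<open>The subspace \<open>L'\<close>.\<close>

definition derived :: "('a, 'c) ring_scheme \<Rightarrow> ('a, 'b, 'd) dialgebra_scheme \<Rightarrow> 'b set"
  where "derived F L = module.span F L
    ({x \<stileturn>\<^bsub>L\<^esub> y | x y. x \<in> carrier L \<and> y \<in> carrier L} \<union>
     {x \<turnstile>\<^bsub>L\<^esub> y | x y. x \<in> carrier L \<and> y \<in> carrier L})"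

definition dialgebra_center :: "('a, 'b, 'd) dialgebra_scheme \<Rightarrow> 'b set"
  where "dialgebra_center L = {z \<in> carrier L. \<forall>x\<in>carrier L.
    z \<stileturn>\<^bsub>L\<^esub> x = \<zero>\<^bsub>L\<^esub> \<and> x \<stileturn>\<^bsub>L\<^esub> z = \<zero>\<^bsub>L\<^esub> \<and> z \<turnstile>\<^bsub>L\<^esub> x = \<zero>\<^bsub>L\<^esub> \<and> x \<turnstile>\<^bsub>L\<^esub> z = \<zero>\<^bsub>L\<^esub>}"

definition dialgebra_ideal ::
    "('a, 'c) ring_scheme \<Rightarrow> 'b set \<Rightarrow> ('a, 'b, 'd) dialgebra_scheme \<Rightarrow> bool"
  where "dialgebra_ideal F I L \<longleftrightarrow> subspace F I L \<and>
    (\<forall>i\<in>I. \<forall>x\<in>carrier L.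
      i \<stileturn>\<^bsub>L\<^esub> x \<in> I \<and> x \<stileturn>\<^bsub>L\<^esub> i \<in> I \<and> i \<turnstile>\<^bsub>L\<^esub> x \<in> I \<and> x \<turnstile>\<^bsub>L\<^esub> i \<in> I)"

definition central_ideal ::
    "('a, 'c) ring_scheme \<Rightarrow> 'b set \<Rightarrow> ('a, 'b, 'd) dialgebra_scheme \<Rightarrow> bool"
  where "central_ideal F I L \<longleftrightarrow> dialgebra_ideal F I L \<and> I \<subseteq> dialgebra_center L"

definition quot_dialgebra ::
    "('a, 'b, 'd) dialgebra_scheme \<Rightarrow> 'b set \<Rightarrow> ('a, 'b set) dialgebra"
  where "quot_dialgebra L I = module.extend (quot_space L I)
    \<lparr>lprod = (\<lambda>X Y. \<Union>x\<in>X. \<Union>y\<in>Y. I +>\<^bsub>L\<^esub> (x \<stileturn>\<^bsub>L\<^esub> y)),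
     rprod = (\<lambda>X Y. \<Union>x\<in>X. \<Union>y\<in>Y. I +>\<^bsub>L\<^esub> (x \<turnstile>\<^bsub>L\<^esub> y))\<rparr>"

section \<open>Second cohomology with coefficients in the base field\<close>

definition cocycles :: "('a, 'c) ring_scheme \<Rightarrow> ('a, 'b, 'd) dialgebra_scheme
    \<Rightarrow> (('b \<times> 'b \<Rightarrow> 'a) \<times> ('b \<times> 'b \<Rightarrow> 'a)) set"
  where "cocycles F B =
    {(fl, fr). fl \<in> carrier (Bil F B B) \<and> fr \<in> carrier (Bil F B B) \<and>
      (\<forall>i\<in>carrier B. \<forall>j\<in>carrier B. \<forall>k\<in>carrier B.
        fl (i, j \<stileturn>\<^bsub>B\<^esub> k) = fl (i, j \<turnstile>\<^bsub>B\<^esub> k) \<and>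
        fl (i \<turnstile>\<^bsub>B\<^esub> j, k) = fr (i, j \<stileturn>\<^bsub>B\<^esub> k) \<and>
        fr (i \<stileturn>\<^bsub>B\<^esub> j, k) = fr (i \<turnstile>\<^bsub>B\<^esub> j, k) \<and>
        fl (i, j \<stileturn>\<^bsub>B\<^esub> k) = fl (i \<stileturn>\<^bsub>B\<^esub> j, k) \<and>
        fr (i, j \<turnstile>\<^bsub>B\<^esub> k) = fr (i \<turnstile>\<^bsub>B\<^esub> j, k))}"

definition cocycle_space :: "('a, 'c) ring_scheme \<Rightarrow> ('a, 'b, 'd) dialgebra_scheme
    \<Rightarrow> ('a, ('b \<times> 'b \<Rightarrow> 'a) \<times> ('b \<times> 'b \<Rightarrow> 'a)) module"
  where "cocycle_space F B =
    (direct_sum (Bil F B B) (Bil F B B))\<lparr>carrier := cocycles F B\<rparr>"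

definition coboundaries :: "('a, 'c) ring_scheme \<Rightarrow> ('a, 'b, 'd) dialgebra_scheme
    \<Rightarrow> (('b \<times> 'b \<Rightarrow> 'a) \<times> ('b \<times> 'b \<Rightarrow> 'a)) set"
  where "coboundaries F B =
    {(\<lambda>(i, j)\<in>carrier B \<times> carrier B. \<ominus>\<^bsub>F\<^esub> e (i \<stileturn>\<^bsub>B\<^esub> j),
      \<lambda>(i, j)\<in>carrier B \<times> carrier B. \<ominus>\<^bsub>F\<^esub> e (i \<turnstile>\<^bsub>B\<^esub> j)) | e. e \<in> linear_forms F B}"

definition H2 :: "('a, 'c) ring_scheme \<Rightarrow> ('a, 'b, 'd) dialgebra_scheme
    \<Rightarrow> ('a, (('b \<times> 'b \<Rightarrow> 'a) \<times> ('b \<times> 'b \<Rightarrow> 'a)) set) module"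
  where "H2 F B = quot_space (cocycle_space F B) (coboundaries F B)"

section \<open>The maps of the sequence\<close>

text \<open>
  Functions on cosets that are given on representatives are rendered by \<^const>\<open>the_elem\<close> of the
  image of the coset, as for the first isomorphism theorem in \<^theory>\<open>HOL-Algebra.Coset\<close>.
\<close>

definition inflate :: "('a, 'b, 'd) dialgebra_scheme \<Rightarrow> 'b set
    \<Rightarrow> ('b set \<times> 'b set \<Rightarrow> 'a) \<Rightarrow> ('b \<times> 'b \<Rightarrow> 'a)"
  where "inflate L Z f = (\<lambda>(x, y)\<in>carrier L \<times> carrier L. f (Z +>\<^bsub>L\<^esub> x, Z +>\<^bsub>L\<^esub> y))"

definition Inf_map :: "('a, 'c) ring_scheme \<Rightarrow> ('a, 'b, 'd) dialgebra_scheme \<Rightarrow> 'b set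
    \<Rightarrow> (('b set \<times> 'b set \<Rightarrow> 'a) \<times> ('b set \<times> 'b set \<Rightarrow> 'a)) set
    \<Rightarrow> (('b \<times> 'b \<Rightarrow> 'a) \<times> ('b \<times> 'b \<Rightarrow> 'a)) set"
  where "Inf_map F L Z X = the_elem
    ((\<lambda>(fl, fr). coboundaries F L +>\<^bsub>cocycle_space F L\<^esub> (inflate L Z fl, inflate L Z fr)) ` X)"

definition delta_left :: "('a, 'c) ring_scheme \<Rightarrow> ('a, 'b, 'd) dialgebra_scheme \<Rightarrow> 'b set
    \<Rightarrow> ('b \<times> 'b \<Rightarrow> 'a) \<Rightarrow> ('b set \<times> 'b \<Rightarrow> 'a)"
  where "delta_left F L Z f =
    (\<lambda>(X, z)\<in>carrier (quot_space L (derived F L)) \<times> Z. the_elem ((\<lambda>x. f (x, z)) ` X))"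

definition delta_right :: "('a, 'c) ring_scheme \<Rightarrow> ('a, 'b, 'd) dialgebra_scheme \<Rightarrow> 'b set
    \<Rightarrow> ('b \<times> 'b \<Rightarrow> 'a) \<Rightarrow> ('b \<times> 'b set \<Rightarrow> 'a)"
  where "delta_right F L Z f =
    (\<lambda>(z, X)\<in>Z \<times> carrier (quot_space L (derived F L)). the_elem ((\<lambda>x. f (z, x)) ` X))"

definition delta_map :: "('a, 'c) ring_scheme \<Rightarrow> ('a, 'b, 'd) dialgebra_scheme \<Rightarrow> 'b set
    \<Rightarrow> (('b \<times> 'b \<Rightarrow> 'a) \<times> ('b \<times> 'b \<Rightarrow> 'a)) set
    \<Rightarrow> (('b set \<times> 'b \<Rightarrow> 'a) \<times> ('b \<times> 'b set \<Rightarrow> 'a)) \<times> (('b set \<times> 'b \<Rightarrow> 'a) \<times> ('b \<times> 'b set \<Rightarrow> 'a))"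
  where "delta_map F L Z X = the_elem
    ((\<lambda>(fl, fr). ((delta_left F L Z fl, delta_right F L Z fl),
                  (delta_left F L Z fr, delta_right F L Z fr))) ` X)"

definition delta_target :: "('a, 'c) ring_scheme \<Rightarrow> ('a, 'b, 'd) dialgebra_scheme \<Rightarrow> 'b set
    \<Rightarrow> ('a, (('b set \<times> 'b \<Rightarrow> 'a) \<times> ('b \<times> 'b set \<Rightarrow> 'a)) \<times>
            (('b set \<times> 'b \<Rightarrow> 'a) \<times> ('b \<times> 'b set \<Rightarrow> 'a))) module"
  where "delta_target F L Z =
    (let Q = quot_space L (derived F L);
         V = L\<lparr>carrier := Z\<rparr>;
         P = direct_sum (Bil F Q V) (Bil F V Q)
     in direct_sum P P)"

end

theory Submission
  imports Defs
begin

text \<open>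
  Every cocycle identity moves a product out of one argument and a central element into a product,
  so a cocycle on \<open>L\<close> vanishes on \<open>L' \<times> Z\<close> and \<open>Z \<times> L'\<close>; a coboundary vanishes even on
  \<open>L \<times> Z\<close> and \<open>Z \<times> L\<close>. Hence \<open>\<delta>\<close> is well defined on classes, and it kills a class if and only
  if some (equivalently every) representing cocycle vanishes on \<open>L \<times> Z\<close> and \<open>Z \<times> L\<close>, that is,
  descends to a cocycle on \<open>L/Z\<close>, whose inflation it then is. So exactness already holds at the
  level of cocycles.
\<close>

section \<open>Quotient spaces\<close>

text \<open>Lets a record inherit the vector space structure from another one with the same
  operations, possibly of a different record type. It is applied to \<open>Bil\<close> and to
  \<open>quot_dialgebra\<close>, which adds two products to \<open>quot_space\<close>.\<close>

lemma vectorspace_cong: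
  assumes "vectorspace K V"
    and "carrier W = carrier V" "zero W = zero V" "add W = add V" "smult W = smult V"
  shows "vectorspace K W"
proof -
  interpret vectorspace K V by fact
  show ?thesis
    by (rule vs_criteria)
      (use M.add.r_inv_ex in \<open>auto simp: assms M.a_ac smult_assoc1 smult_l_distr
        smult_r_distr intro: field_axioms\<close>)
qed

lemma (in vectorspace) subspaceI:
  assumes "N \<subseteq> carrier V" "\<zero>\<^bsub>V\<^esub> \<in> N"
    and "\<And>x y. x \<in> N \<Longrightarrow> y \<in> N \<Longrightarrow> x \<oplus>\<^bsub>V\<^esub> y \<in> N"
    and "\<And>a x. a \<in> carrier K \<Longrightarrow> x \<in> N \<Longrightarrow> a \<odot>\<^bsub>V\<^esub> x \<in> N"
  shows "subspace K N V"
  using assms by unfold_locales auto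

lemma module_hom_compose:
  assumes "f \<in> module_hom R M N" "g \<in> module_hom R N P"
  shows "(\<lambda>x. g (f x)) \<in> module_hom R M P"
  using assms by (auto simp: module_hom_def Pi_iff)

lemma linear_mapI:
  assumes "vectorspace K V" "vectorspace K W" "f \<in> module_hom K V W"
  shows "linear_map K V W f"
  using assms by (simp add: linear_map_def mod_hom_def mod_hom_axioms_def vectorspace_def)

text \<open>Instantiated in three ways: with \<open>Z\<close> in \<open>L\<close>, with
  \<open>derived F L\<close> in \<open>L\<close>, and with the coboundaries in the cocycle space.
  The same lemmas thus serve all quotients of the sequence.\<close>

locale quotient_space = vectorspace K V for K and V (structure) +
  fixes N
  assumes subspace: "subspace K N V"
begin

lemma submodule: "submodule K N V"
  using subspace by (simp add: subspace_def)

lemma N_subset: "N \<subseteq> carrier V"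
  using submodule by (simp add: submodule_def)

lemma N_carrier [simp]: "n \<in> N \<Longrightarrow> n \<in> carrier V"
  using N_subset by auto

lemma N_smult: "a \<in> carrier K \<Longrightarrow> n \<in> N \<Longrightarrow> a \<odot>\<^bsub>V\<^esub> n \<in> N"
  using submodule by (simp add: submodule_def)

sublocale N: abelian_subgroup N V
proof (rule abelian_subgroupI3[OF additive_subgroupI])
  \<comment> \<open>Closure under negation is closure under the scalar \<open>-1\<close>.\<close>
  have "\<ominus>\<^bsub>V\<^esub> n \<in> N" if "n \<in> N" for n
    using N_smult[of "\<ominus>\<^bsub>K\<^esub> \<one>\<^bsub>K\<^esub>" n] that by (simp add: smult_minus_1)
  then show "subgroup N (add_monoid V)"
    using submodule N_subset
    by (intro M.add.subgroupI) (auto simp: submodule_def a_inv_def[symmetric])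
qed (rule M.abelian_group_axioms)

lemma coset_mem_iff: "y \<in> N +>\<^bsub>V\<^esub> x \<longleftrightarrow> (\<exists>n\<in>N. y = n \<oplus>\<^bsub>V\<^esub> x)"
  by (auto simp: a_r_coset_def')

lemma coset_add_absorb:
  assumes "n \<in> N" "x \<in> carrier V"
  shows "N +>\<^bsub>V\<^esub> (n \<oplus>\<^bsub>V\<^esub> x) = N +>\<^bsub>V\<^esub> x"
  using M.a_repr_independence[OF _ _ N.a_subgroup] assms coset_mem_iff by metis

text \<open>Evaluates maps given on representatives: a function constant along the coset has a
  singleton image there, from which \<open>the_elem\<close> or a union extracts the value.\<close>

lemma image_coset:
  assumes "x \<in> carrier V" "\<And>n. n \<in> N \<Longrightarrow> g (n \<oplus>\<^bsub>V\<^esub> x) = g x"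
  shows "g ` (N +>\<^bsub>V\<^esub> x) = {g x}"
  using assms N.a_rcos_self[OF assms(1)] by (auto simp: coset_mem_iff)

text \<open>The two-variable form, for the products of the quotient algebra and for the bilinear
  forms on it.\<close>

lemma image_coset2:
  assumes "x \<in> carrier V" "y \<in> carrier V"
    and "\<And>m n. \<lbrakk>m \<in> N; n \<in> N\<rbrakk> \<Longrightarrow> g (m \<oplus>\<^bsub>V\<^esub> x, n \<oplus>\<^bsub>V\<^esub> y) = g (x, y)"
  shows "g ` ((N +>\<^bsub>V\<^esub> x) \<times> (N +>\<^bsub>V\<^esub> y)) = {g (x, y)}"
  using assms N.a_rcos_self[OF assms(1)] N.a_rcos_self[OF assms(2)]
  by (auto simp: coset_mem_iff)

lemma quot_carrier: "carrier (quot_space V N) = (\<lambda>x. N +>\<^bsub>V\<^esub> x) ` carrier V"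
  by (auto simp: quot_space_def A_RCOSETS_def')

text \<open>The zero of the quotient is \<open>N\<close> itself; written as the coset of zero it
  fits the rules for sums and multiples.\<close>

lemma quot_zero: "\<zero>\<^bsub>quot_space V N\<^esub> = N +>\<^bsub>V\<^esub> \<zero>\<^bsub>V\<^esub>"
  using N_subset by (simp add: quot_space_def)

lemma quot_add:
  "\<lbrakk>x \<in> carrier V; y \<in> carrier V\<rbrakk> \<Longrightarrow>
    (N +>\<^bsub>V\<^esub> x) \<oplus>\<^bsub>quot_space V N\<^esub> (N +>\<^bsub>V\<^esub> y) = N +>\<^bsub>V\<^esub> (x \<oplus>\<^bsub>V\<^esub> y)"
  by (simp add: quot_space_def N.a_rcos_sum)

lemma quot_smult:
  assumes "a \<in> carrier K" "x \<in> carrier V"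
  shows "a \<odot>\<^bsub>quot_space V N\<^esub> (N +>\<^bsub>V\<^esub> x) = N +>\<^bsub>V\<^esub> (a \<odot>\<^bsub>V\<^esub> x)"
proof -
  \<comment> \<open>Scaling another representative \<open>n + x\<close> adds \<open>a n\<close>,
    which lies in \<open>N\<close>. So the union that defines the multiple runs over a single
    coset.\<close>
  have "(\<lambda>y. N +>\<^bsub>V\<^esub> (a \<odot>\<^bsub>V\<^esub> y)) ` (N +>\<^bsub>V\<^esub> x) = {N +>\<^bsub>V\<^esub> (a \<odot>\<^bsub>V\<^esub> x)}"
    using assms by (intro image_coset) (simp_all add: smult_r_distr coset_add_absorb N_smult)
  then show ?thesis by (simp add: quot_space_def)
qed

lemma vectorspace_quot: "vectorspace K (quot_space V N)"
proof (rule vs_criteria, goal_cases)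
  case 1 show ?case by (rule field_axioms)
next
  case 4
  \<comment> \<open>Negatives: the class of \<open>-x\<close> is the inverse of the class of
    \<open>x\<close>.\<close>
  have "(N +>\<^bsub>V\<^esub> x) \<oplus>\<^bsub>quot_space V N\<^esub> (N +>\<^bsub>V\<^esub> (\<ominus>\<^bsub>V\<^esub> x)) = \<zero>\<^bsub>quot_space V N\<^esub>"
    if "x \<in> carrier V" for x
    using that by (simp add: quot_add quot_zero M.r_neg)
  then show ?case
    unfolding quot_carrier by (metis (no_types, lifting) M.a_inv_closed imageE imageI)
qed (auto simp: quot_carrier quot_add quot_zero quot_smult M.a_ac smult_assoc1
      smult_l_distr smult_r_distr)

lemma coset_hom: "(\<lambda>x. N +>\<^bsub>V\<^esub> x) \<in> module_hom K V (quot_space V N)"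
  by (auto simp: module_hom_def quot_carrier quot_add quot_smult)

section \<open>Linear maps induced on a quotient\<close>

context
  fixes W g
  assumes W: "vectorspace K W" and g: "g \<in> module_hom K V W"
    and g_N: "\<And>n. n \<in> N \<Longrightarrow> g n = \<zero>\<^bsub>W\<^esub>"
begin

text \<open>For \<open>n\<close> in \<open>N\<close>, \<open>g (n + x) = g n + g x = g x\<close>, so
  \<open>g\<close> is constant on the coset.\<close>

lemma induced_coset:
  assumes "x \<in> carrier V"
  shows "the_elem (g ` (N +>\<^bsub>V\<^esub> x)) = g x"
proof -
  interpret W: vectorspace K W by (rule W)
  have "g x \<in> carrier W" using g assms by (auto simp: module_hom_def)
  then show ?thesis
    using assms by (simp add: image_coset module_hom_add[OF g] g_N)
qed

text \<open>The homomorphism theorem. Both \<open>Inf_map\<close> and \<open>delta_map\<close> are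
  obtained from it, with \<open>g\<close> a linear map on cocycles.\<close>

lemma induced_linear: "linear_map K (quot_space V N) W (\<lambda>X. the_elem (g ` X))"
proof (rule linear_mapI[OF vectorspace_quot W])
  show "(\<lambda>X. the_elem (g ` X)) \<in> module_hom K (quot_space V N) W"
    using g by (auto simp: module_hom_def quot_carrier quot_add quot_smult induced_coset)
qed

end

end

section \<open>Bilinear forms\<close>

context field
begin

lemma Bil_zero: "\<zero>\<^bsub>Bil R U V\<^esub> = (\<lambda>p\<in>carrier U \<times> carrier V. \<zero>)"
  by (simp add: Bil_def func_space_def)

lemma Bil_add: "f \<oplus>\<^bsub>Bil R U V\<^esub> g = (\<lambda>p\<in>carrier U \<times> carrier V. f p \<oplus> g p)"
  by (simp add: Bil_def func_space_def)

lemma Bil_smult: "a \<odot>\<^bsub>Bil R U V\<^esub> f = (\<lambda>p\<in>carrier U \<times> carrier V. a \<otimes> f p)"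
  by (simp add: Bil_def func_space_def)

text \<open>Unfolds linearity in each variable and the function space condition into pointwise
  equations, the form in which bilinearity is checked and used below.\<close>

lemma Bil_iff:
  "f \<in> carrier (Bil R U V) \<longleftrightarrow> f \<in> extensional (carrier U \<times> carrier V) \<and>
    (\<forall>u\<in>carrier U. \<forall>v\<in>carrier V. f (u, v) \<in> carrier R \<and>
      (\<forall>u'\<in>carrier U. f (u \<oplus>\<^bsub>U\<^esub> u', v) = f (u, v) \<oplus> f (u', v)) \<and>
      (\<forall>v'\<in>carrier V. f (u, v \<oplus>\<^bsub>V\<^esub> v') = f (u, v) \<oplus> f (u, v')) \<and>
      (\<forall>a\<in>carrier R. f (a \<odot>\<^bsub>U\<^esub> u, v) = a \<otimes> f (u, v) \<and> f (u, a \<odot>\<^bsub>V\<^esub> v) = a \<otimes> f (u, v)))"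
  by (auto simp: Bil_def linear_forms_def PiE_def Pi_iff)

lemma Bil_eqI:
  assumes "f \<in> extensional (carrier U \<times> carrier V)" "g \<in> extensional (carrier U \<times> carrier V)"
    and "\<And>u v. \<lbrakk>u \<in> carrier U; v \<in> carrier V\<rbrakk> \<Longrightarrow> f (u, v) = g (u, v)"
  shows "f = g"
  using assms by (auto intro!: extensionalityI)

context
  fixes U V f
  assumes f: "f \<in> carrier (Bil R U V)"
begin

lemma Bil_closed: "\<lbrakk>u \<in> carrier U; v \<in> carrier V\<rbrakk> \<Longrightarrow> f (u, v) \<in> carrier R"
  using f by (simp add: Bil_iff)

lemma Bil_add_left:
  "\<lbrakk>u \<in> carrier U; u' \<in> carrier U; v \<in> carrier V\<rbrakk> \<Longrightarrow> f (u \<oplus>\<^bsub>U\<^esub> u', v) = f (u, v) \<oplus> f (u', v)"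
  using f by (simp add: Bil_iff)

lemma Bil_add_right:
  "\<lbrakk>u \<in> carrier U; v \<in> carrier V; v' \<in> carrier V\<rbrakk> \<Longrightarrow> f (u, v \<oplus>\<^bsub>V\<^esub> v') = f (u, v) \<oplus> f (u, v')"
  using f by (simp add: Bil_iff)

lemma Bil_smult_left:
  "\<lbrakk>a \<in> carrier R; u \<in> carrier U; v \<in> carrier V\<rbrakk> \<Longrightarrow> f (a \<odot>\<^bsub>U\<^esub> u, v) = a \<otimes> f (u, v)"
  using f by (simp add: Bil_iff)

lemma Bil_smult_right:
  "\<lbrakk>a \<in> carrier R; u \<in> carrier U; v \<in> carrier V\<rbrakk> \<Longrightarrow> f (u, a \<odot>\<^bsub>V\<^esub> v) = a \<otimes> f (u, v)"
  using f by (simp add: Bil_iff)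

lemma Bil_extensional: "f \<in> extensional (carrier U \<times> carrier V)"
  using f by (simp add: Bil_iff)

end

text \<open>Bilinear forms are closed under the pointwise operations, hence a subspace of the space
  of all functions on the product of the carriers.\<close>

lemma vectorspace_Bil:
  assumes "vectorspace R U" "vectorspace R V"
  shows "vectorspace R (Bil R U V)"
proof -
  interpret U: vectorspace R U by fact
  interpret V: vectorspace R V by fact
  let ?S = "func_space (carrier U \<times> carrier V)"
  interpret S: vectorspace R ?S by (rule U.func_space_is_vs)
  have "subspace R (carrier (Bil R U V)) ?S"
  proof (rule S.subspaceI)
    show "carrier (Bil R U V) \<subseteq> carrier ?S" by (auto simp: Bil_def func_space_def)
    show "\<zero>\<^bsub>?S\<^esub> \<in> carrier (Bil R U V)" by (simp add: func_space_def Bil_iff)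
  next
    fix f g assume *: "f \<in> carrier (Bil R U V)" "g \<in> carrier (Bil R U V)"
    show "f \<oplus>\<^bsub>?S\<^esub> g \<in> carrier (Bil R U V)"
      using * by (simp add: func_space_def Bil_iff r_distr a_ac)
  next
    fix a f assume *: "a \<in> carrier R" "f \<in> carrier (Bil R U V)"
    show "a \<odot>\<^bsub>?S\<^esub> f \<in> carrier (Bil R U V)"
      using * by (simp add: func_space_def Bil_iff r_distr m_ac)
  qed
  from S.subspace_is_vs[OF this] show ?thesis
    by (rule vectorspace_cong) (simp_all add: Bil_def)
qed

end

section \<open>Cocycles\<close>

context diassociative_algebra
begin

lemma prod_closed [simp]:
  assumes "x \<in> carrier L" "y \<in> carrier L"
  shows "x \<stileturn>\<^bsub>L\<^esub> y \<in> carrier L" "x \<turnstile>\<^bsub>L\<^esub> y \<in> carrier L"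
  using assms lprod_linear_left[of y] rprod_linear_left[of y] by (auto simp: module_hom_def)

lemma prod_add:
  assumes "x \<in> carrier L" "y \<in> carrier L" "z \<in> carrier L"
  shows "(x \<oplus>\<^bsub>L\<^esub> y) \<stileturn>\<^bsub>L\<^esub> z = x \<stileturn>\<^bsub>L\<^esub> z \<oplus>\<^bsub>L\<^esub> y \<stileturn>\<^bsub>L\<^esub> z"
    "z \<stileturn>\<^bsub>L\<^esub> (x \<oplus>\<^bsub>L\<^esub> y) = z \<stileturn>\<^bsub>L\<^esub> x \<oplus>\<^bsub>L\<^esub> z \<stileturn>\<^bsub>L\<^esub> y"
    "(x \<oplus>\<^bsub>L\<^esub> y) \<turnstile>\<^bsub>L\<^esub> z = x \<turnstile>\<^bsub>L\<^esub> z \<oplus>\<^bsub>L\<^esub> y \<turnstile>\<^bsub>L\<^esub> z"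
    "z \<turnstile>\<^bsub>L\<^esub> (x \<oplus>\<^bsub>L\<^esub> y) = z \<turnstile>\<^bsub>L\<^esub> x \<oplus>\<^bsub>L\<^esub> z \<turnstile>\<^bsub>L\<^esub> y"
  using assms lprod_linear_left[of z] lprod_linear_right[of z]
    rprod_linear_left[of z] rprod_linear_right[of z] by (auto simp: module_hom_def)

lemma prod_smult:
  assumes "a \<in> carrier F" "x \<in> carrier L" "y \<in> carrier L"
  shows "(a \<odot>\<^bsub>L\<^esub> x) \<stileturn>\<^bsub>L\<^esub> y = a \<odot>\<^bsub>L\<^esub> (x \<stileturn>\<^bsub>L\<^esub> y)"
    "x \<stileturn>\<^bsub>L\<^esub> (a \<odot>\<^bsub>L\<^esub> y) = a \<odot>\<^bsub>L\<^esub> (x \<stileturn>\<^bsub>L\<^esub> y)"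
    "(a \<odot>\<^bsub>L\<^esub> x) \<turnstile>\<^bsub>L\<^esub> y = a \<odot>\<^bsub>L\<^esub> (x \<turnstile>\<^bsub>L\<^esub> y)"
    "x \<turnstile>\<^bsub>L\<^esub> (a \<odot>\<^bsub>L\<^esub> y) = a \<odot>\<^bsub>L\<^esub> (x \<turnstile>\<^bsub>L\<^esub> y)"
  using assms lprod_linear_left[of y] lprod_linear_right[of x]
    rprod_linear_left[of y] rprod_linear_right[of x] by (auto simp: module_hom_def)

lemma vectorspace_L: "vectorspace F L" ..

text \<open>The cocycle identities, oriented so that they terminate as rewrite rules.\<close>

lemma cocycles_iff:
  "(fl, fr) \<in> cocycles F L \<longleftrightarrow> fl \<in> carrier (Bil F L L) \<and> fr \<in> carrier (Bil F L L) \<and>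
    (\<forall>i\<in>carrier L. \<forall>j\<in>carrier L. \<forall>k\<in>carrier L.
        fl (i, j \<stileturn>\<^bsub>L\<^esub> k) = fl (i, j \<turnstile>\<^bsub>L\<^esub> k) \<and>
        fr (i, j \<stileturn>\<^bsub>L\<^esub> k) = fl (i \<turnstile>\<^bsub>L\<^esub> j, k) \<and>
        fr (i \<stileturn>\<^bsub>L\<^esub> j, k) = fr (i \<turnstile>\<^bsub>L\<^esub> j, k) \<and>
        fl (i \<stileturn>\<^bsub>L\<^esub> j, k) = fl (i, j \<turnstile>\<^bsub>L\<^esub> k) \<and>
        fr (i, j \<turnstile>\<^bsub>L\<^esub> k) = fr (i \<turnstile>\<^bsub>L\<^esub> j, k))"
  unfolding cocycles_def mem_Collect_eq prod.case by (intro conj_cong refl ball_cong) auto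

lemma cocycle_space_simps:
  "carrier (cocycle_space F L) = cocycles F L"
  "\<zero>\<^bsub>cocycle_space F L\<^esub> = (\<zero>\<^bsub>Bil F L L\<^esub>, \<zero>\<^bsub>Bil F L L\<^esub>)"
  "(fl, fr) \<oplus>\<^bsub>cocycle_space F L\<^esub> (gl, gr) = (fl \<oplus>\<^bsub>Bil F L L\<^esub> gl, fr \<oplus>\<^bsub>Bil F L L\<^esub> gr)"
  "a \<odot>\<^bsub>cocycle_space F L\<^esub> (fl, fr) = (a \<odot>\<^bsub>Bil F L L\<^esub> fl, a \<odot>\<^bsub>Bil F L L\<^esub> fr)"
  by (simp_all add: cocycle_space_def direct_sum_def)

text \<open>The zero vector is \<open>0 x\<close>, and the scalar \<open>0\<close> comes out of
  either argument.\<close>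

lemma Bil_zero_arg:
  assumes f: "f \<in> carrier (Bil F L L)" and x: "x \<in> carrier L"
  shows "f (\<zero>\<^bsub>L\<^esub>, x) = \<zero>\<^bsub>F\<^esub>" "f (x, \<zero>\<^bsub>L\<^esub>) = \<zero>\<^bsub>F\<^esub>"
  using Bil_smult_left[OF f, of "\<zero>\<^bsub>F\<^esub>" x x] Bil_smult_right[OF f, of "\<zero>\<^bsub>F\<^esub>" x x]
    Bil_closed[OF f x x] x by simp_all

sublocale Bil: vectorspace F "Bil F L L"
  by (rule vectorspace_Bil[OF vectorspace_L vectorspace_L])

text \<open>Each cocycle identity is linear in the pair of forms, so its solutions form a subspace
  of the direct sum of two copies of \<open>Bil F L L\<close>.\<close>

lemma vectorspace_cocycle_space: "vectorspace F (cocycle_space F L)"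
proof -
  let ?D = "direct_sum (Bil F L L) (Bil F L L)"
  interpret D: vectorspace F ?D
    by (rule direct_sum_is_vs) (rule Bil.vectorspace_axioms)+
  have "subspace F (cocycles F L) ?D"
  proof (rule D.subspaceI)
    show "cocycles F L \<subseteq> carrier ?D" by (auto simp: cocycles_def direct_sum_def)
    \<comment> \<open>Here and in the next two cases membership in \<open>Bil\<close> is settled
      while the operation is still folded; only then is its pointwise formula unfolded for the
      cocycle identities.\<close>
    show "\<zero>\<^bsub>?D\<^esub> \<in> cocycles F L"
      using Bil.M.zero_closed by (simp add: direct_sum_def cocycles_iff) (simp add: Bil_zero)
  next
    fix f g assume *: "f \<in> cocycles F L" "g \<in> cocycles F L"
    obtain fl fr gl gr where [simp]: "f = (fl, fr)" "g = (gl, gr)" by fastforce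
    show "f \<oplus>\<^bsub>?D\<^esub> g \<in> cocycles F L"
      using * by (simp add: direct_sum_def cocycles_iff) (auto simp: Bil_add)
  next
    fix a f assume *: "a \<in> carrier F" "f \<in> cocycles F L"
    obtain fl fr where [simp]: "f = (fl, fr)" by fastforce
    show "a \<odot>\<^bsub>?D\<^esub> f \<in> cocycles F L"
      using * by (simp add: direct_sum_def cocycles_iff) (auto simp: Bil_smult)
  qed
  from D.subspace_is_vs[OF this] show ?thesis by (simp add: cocycle_space_def)
qed

sublocale C: vectorspace F "cocycle_space F L"
  by (rule vectorspace_cocycle_space)

section \<open>Coboundaries and second cohomology\<close>

definition coboundary where
  "coboundary e = (\<lambda>(i, j)\<in>carrier L \<times> carrier L. \<ominus>\<^bsub>F\<^esub> e (i \<stileturn>\<^bsub>L\<^esub> j),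
    \<lambda>(i, j)\<in>carrier L \<times> carrier L. \<ominus>\<^bsub>F\<^esub> e (i \<turnstile>\<^bsub>L\<^esub> j))"

text \<open>Presents the coboundaries as an image of the dual space, so that their closure
  properties come from linearity in \<open>e\<close>.\<close>

lemma coboundaries_eq: "coboundaries F L = coboundary ` linear_forms F L"
  by (auto simp: coboundaries_def coboundary_def)

text \<open>Each cocycle identity compares the values of \<open>-e\<close> at two triple products,
  and one of the five axioms says that these products agree.\<close>

lemma coboundary_cocycle:
  assumes "e \<in> linear_forms F L"
  shows "coboundary e \<in> cocycles F L"
proof -
  have [simp]: "e x \<in> carrier F" if "x \<in> carrier L" for x
    using assms that by (auto simp: linear_forms_def)
  have "fst (coboundary e) \<in> carrier (Bil F L L)" "snd (coboundary e) \<in> carrier (Bil F L L)"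
    using assms
    by (auto simp: coboundary_def Bil_iff linear_forms_def prod_add prod_smult R.minus_add R.r_minus)
  then show ?thesis
    by (simp add: coboundary_def cocycles_iff lprod_assoc rprod_assoc lprod_lprod_eq_lprod_rprod
      rprod_lprod_assoc lprod_rprod_eq_rprod_rprod)
qed

text \<open>The coboundary depends linearly on the form: the zero form, \<open>d + e\<close> and
  \<open>a e\<close> witness closure under zero, sums and multiples.\<close>

lemma subspace_coboundaries: "subspace F (coboundaries F L) (cocycle_space F L)"
proof (rule C.subspaceI)
  show "coboundaries F L \<subseteq> carrier (cocycle_space F L)"
    by (auto simp: coboundaries_eq coboundary_cocycle cocycle_space_simps)
next
  have "(\<lambda>_. \<zero>\<^bsub>F\<^esub>) \<in> linear_forms F L" by (simp add: linear_forms_def)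
  moreover have "coboundary (\<lambda>_. \<zero>\<^bsub>F\<^esub>) = \<zero>\<^bsub>cocycle_space F L\<^esub>"
    by (auto simp: coboundary_def cocycle_space_simps Bil_zero)
  ultimately show "\<zero>\<^bsub>cocycle_space F L\<^esub> \<in> coboundaries F L"
    unfolding coboundaries_eq by (metis image_eqI)
next
  fix f g assume "f \<in> coboundaries F L" "g \<in> coboundaries F L"
  then obtain d e where de: "d \<in> linear_forms F L" "e \<in> linear_forms F L"
    and [simp]: "f = coboundary d" "g = coboundary e"
    by (auto simp: coboundaries_eq)
  have [simp]: "d x \<in> carrier F" "e x \<in> carrier F" if "x \<in> carrier L" for x
    using de that by (auto simp: linear_forms_def)
  have "(\<lambda>x. d x \<oplus>\<^bsub>F\<^esub> e x) \<in> linear_forms F L"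
    using de by (auto simp: linear_forms_def R.a_ac R.r_distr)
  moreover have "f \<oplus>\<^bsub>cocycle_space F L\<^esub> g = coboundary (\<lambda>x. d x \<oplus>\<^bsub>F\<^esub> e x)"
    by (auto simp: coboundary_def cocycle_space_simps Bil_add R.minus_add)
  ultimately show "f \<oplus>\<^bsub>cocycle_space F L\<^esub> g \<in> coboundaries F L"
    by (simp add: coboundaries_eq)
next
  fix a f assume a: "a \<in> carrier F" and "f \<in> coboundaries F L"
  then obtain e where e: "e \<in> linear_forms F L" and [simp]: "f = coboundary e"
    by (auto simp: coboundaries_eq)
  have [simp]: "e x \<in> carrier F" if "x \<in> carrier L" for x
    using e that by (auto simp: linear_forms_def)
  have "(\<lambda>x. a \<otimes>\<^bsub>F\<^esub> e x) \<in> linear_forms F L"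
    using a e by (auto simp: linear_forms_def R.m_ac R.r_distr)
  moreover have "a \<odot>\<^bsub>cocycle_space F L\<^esub> f = coboundary (\<lambda>x. a \<otimes>\<^bsub>F\<^esub> e x)"
    using a by (auto simp: coboundary_def cocycle_space_simps Bil_smult R.r_minus)
  ultimately show "a \<odot>\<^bsub>cocycle_space F L\<^esub> f \<in> coboundaries F L"
    by (simp add: coboundaries_eq)
qed

lemma H2_quotient_space: "quotient_space F (cocycle_space F L) (coboundaries F L)"
  by (intro quotient_space.intro quotient_space_axioms.intro vectorspace_cocycle_space
      subspace_coboundaries)

lemma vectorspace_H2: "vectorspace F (H2 F L)"
  unfolding H2_def by (rule quotient_space.vectorspace_quot[OF H2_quotient_space])

lemma H2_carrier:
  "carrier (H2 F L) = (\<lambda>c. coboundaries F L +>\<^bsub>cocycle_space F L\<^esub> c) ` cocycles F L"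
  unfolding H2_def
  by (simp add: quotient_space.quot_carrier[OF H2_quotient_space] cocycle_space_simps)

end

section \<open>The quotient algebra\<close>

locale dialgebra_quotient = diassociative_algebra F L
  for F :: "('a, 'c) ring_scheme" and L :: "('a, 'b, 'd) dialgebra_scheme" (structure) +
  fixes Z :: "'b set"
  assumes ideal: "dialgebra_ideal F Z L"
begin

sublocale Z: quotient_space F L Z
  using ideal vectorspace_L
  by (simp add: quotient_space_def quotient_space_axioms_def dialgebra_ideal_def)

abbreviation Q where "Q \<equiv> quot_dialgebra L Z"

abbreviation coset where "coset x \<equiv> Z +>\<^bsub>L\<^esub> x"

lemma ideal_closed:
  assumes "z \<in> Z" "x \<in> carrier L"
  shows "z \<stileturn>\<^bsub>L\<^esub> x \<in> Z" "x \<stileturn>\<^bsub>L\<^esub> z \<in> Z" "z \<turnstile>\<^bsub>L\<^esub> x \<in> Z" "x \<turnstile>\<^bsub>L\<^esub> z \<in> Z"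
  using ideal assms by (auto simp: dialgebra_ideal_def)

lemma quot_dialgebra_simps:
  "carrier Q = coset ` carrier L"
  "\<lbrakk>x \<in> carrier L; y \<in> carrier L\<rbrakk> \<Longrightarrow> coset x \<oplus>\<^bsub>Q\<^esub> coset y = coset (x \<oplus>\<^bsub>L\<^esub> y)"
  "\<lbrakk>a \<in> carrier F; x \<in> carrier L\<rbrakk> \<Longrightarrow> a \<odot>\<^bsub>Q\<^esub> coset x = coset (a \<odot>\<^bsub>L\<^esub> x)"
  by (simp_all add: quot_dialgebra_def module.defs Z.quot_carrier Z.quot_add Z.quot_smult)

lemma coset_in_Q [simp]: "x \<in> carrier L \<Longrightarrow> coset x \<in> carrier Q"
  unfolding quot_dialgebra_simps(1) by (rule imageI)

text \<open>The product of two cosets is a union over all pairs of representatives. It runs over a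
  single coset, since changing a representative changes the product by an element of the
  ideal.\<close>

lemma lprod_coset:
  assumes "x \<in> carrier L" "y \<in> carrier L"
  shows "coset x \<stileturn>\<^bsub>Q\<^esub> coset y = coset (x \<stileturn>\<^bsub>L\<^esub> y)"
proof -
  \<comment> \<open>First the left factor is expanded and the term with factor \<open>m\<close>
    absorbed into \<open>Z\<close>, then the right factor and the term with factor
    \<open>n\<close>.\<close>
  have "coset ((m \<oplus>\<^bsub>L\<^esub> x) \<stileturn>\<^bsub>L\<^esub> (n \<oplus>\<^bsub>L\<^esub> y)) = coset (x \<stileturn>\<^bsub>L\<^esub> y)" if "m \<in> Z" "n \<in> Z" for m n
    using assms that by (simp add: prod_add(1) Z.coset_add_absorb ideal_closed)
      (simp add: prod_add(2) Z.coset_add_absorb ideal_closed)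
  then have "(\<lambda>(x, y). coset (x \<stileturn>\<^bsub>L\<^esub> y)) ` (coset x \<times> coset y) = {coset (x \<stileturn>\<^bsub>L\<^esub> y)}"
    using assms by (subst Z.image_coset2) auto
  moreover have "coset x \<stileturn>\<^bsub>Q\<^esub> coset y = \<Union> ((\<lambda>(x, y). coset (x \<stileturn>\<^bsub>L\<^esub> y)) ` (coset x \<times> coset y))"
    by (auto simp: quot_dialgebra_def module.defs)
  ultimately show ?thesis by simp
qed

lemma rprod_coset:
  assumes "x \<in> carrier L" "y \<in> carrier L"
  shows "coset x \<turnstile>\<^bsub>Q\<^esub> coset y = coset (x \<turnstile>\<^bsub>L\<^esub> y)"
proof -
  have "coset ((m \<oplus>\<^bsub>L\<^esub> x) \<turnstile>\<^bsub>L\<^esub> (n \<oplus>\<^bsub>L\<^esub> y)) = coset (x \<turnstile>\<^bsub>L\<^esub> y)" if "m \<in> Z" "n \<in> Z" for m n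
    using assms that by (simp add: prod_add(3) Z.coset_add_absorb ideal_closed)
      (simp add: prod_add(4) Z.coset_add_absorb ideal_closed)
  then have "(\<lambda>(x, y). coset (x \<turnstile>\<^bsub>L\<^esub> y)) ` (coset x \<times> coset y) = {coset (x \<turnstile>\<^bsub>L\<^esub> y)}"
    using assms by (subst Z.image_coset2) auto
  moreover have "coset x \<turnstile>\<^bsub>Q\<^esub> coset y = \<Union> ((\<lambda>(x, y). coset (x \<turnstile>\<^bsub>L\<^esub> y)) ` (coset x \<times> coset y))"
    by (auto simp: quot_dialgebra_def module.defs)
  ultimately show ?thesis by simp
qed

text \<open>The map \<open>coset\<close> is linear, multiplicative and onto, so every axiom is
  inherited from \<open>L\<close>.\<close>

lemma diassociative_quot: "diassociative_algebra F Q"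
proof -
  have "vectorspace F Q"
    by (rule vectorspace_cong[OF Z.vectorspace_quot]) (simp_all add: quot_dialgebra_def module.defs)
  then show ?thesis
  proof (rule diassociative_algebra.intro[OF _ diassociative_algebra_axioms.intro], goal_cases)
    case (1 y) then show ?case
      by (auto simp: module_hom_def quot_dialgebra_simps lprod_coset prod_add prod_smult)
  next
    case (2 x) then show ?case
      by (auto simp: module_hom_def quot_dialgebra_simps lprod_coset prod_add prod_smult)
  next
    case (3 y) then show ?case
      by (auto simp: module_hom_def quot_dialgebra_simps rprod_coset prod_add prod_smult)
  next
    case (4 x) then show ?case
      by (auto simp: module_hom_def quot_dialgebra_simps rprod_coset prod_add prod_smult)
  next
    case (5 x y z) then show ?case
      by (auto simp: quot_dialgebra_simps lprod_coset rprod_coset lprod_assoc)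
  next
    case (6 x y z) then show ?case
      by (auto simp: quot_dialgebra_simps lprod_coset rprod_coset rprod_assoc)
  next
    case (7 x y z) then show ?case
      by (auto simp: quot_dialgebra_simps lprod_coset rprod_coset lprod_lprod_eq_lprod_rprod)
  next
    case (8 x y z) then show ?case
      by (auto simp: quot_dialgebra_simps lprod_coset rprod_coset rprod_lprod_assoc)
  next
    case (9 x y z) then show ?case
      by (auto simp: quot_dialgebra_simps lprod_coset rprod_coset lprod_rprod_eq_rprod_rprod)
  qed
qed

end

section \<open>The exact sequence\<close>

text \<open>The situation of the theorem: \<open>L\<close> is a central extension of
  \<open>L/Z\<close> by \<open>Z\<close>.\<close>

locale central_extension = dialgebra_quotient F L Z
  for F :: "('a, 'c) ring_scheme" and L :: "('a, 'b, 'd) dialgebra_scheme" (structure)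
    and Z :: "'b set" +
  assumes central: "Z \<subseteq> dialgebra_center L"
begin

lemma central_simps:
  assumes "z \<in> Z" "x \<in> carrier L"
  shows "z \<stileturn>\<^bsub>L\<^esub> x = \<zero>\<^bsub>L\<^esub>" "x \<stileturn>\<^bsub>L\<^esub> z = \<zero>\<^bsub>L\<^esub>" "z \<turnstile>\<^bsub>L\<^esub> x = \<zero>\<^bsub>L\<^esub>" "x \<turnstile>\<^bsub>L\<^esub> z = \<zero>\<^bsub>L\<^esub>"
  using central assms by (auto simp: dialgebra_center_def)

subsection \<open>Inflation\<close>

lemma inflate_apply [simp]:
  "\<lbrakk>x \<in> carrier L; y \<in> carrier L\<rbrakk> \<Longrightarrow> inflate L Z f (x, y) = f (coset x, coset y)"
  by (simp add: inflate_def)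

lemma inflate_extensional: "inflate L Z f \<in> extensional (carrier L \<times> carrier L)"
  by (simp add: inflate_def)

text \<open>A pullback along the linear map \<open>coset\<close>. The rules for the quotient
  operations are read from right to left, which turns the coset of a sum into a sum of
  cosets.\<close>

lemma inflate_Bil:
  assumes "f \<in> carrier (Bil F Q Q)"
  shows "inflate L Z f \<in> carrier (Bil F L L)"
  unfolding Bil_iff
  using Bil_closed[OF assms] Bil_add_left[OF assms] Bil_add_right[OF assms]
    Bil_smult_left[OF assms] Bil_smult_right[OF assms]
  by (auto simp: inflate_extensional quot_dialgebra_simps(2,3)[symmetric])

text \<open>Inflation of cocycles, before the passage to classes.\<close>

definition inflate_pair where
  "inflate_pair = (\<lambda>(fl, fr). (inflate L Z fl, inflate L Z fr))"

text \<open>Since \<open>coset\<close> is multiplicative, each cocycle identity on \<open>Q\<close>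
  pulls back to the same identity on \<open>L\<close>.\<close>

lemma inflate_cocycle:
  assumes "c \<in> cocycles F Q"
  shows "inflate_pair c \<in> cocycles F L"
proof -
  interpret Q: diassociative_algebra F Q by (rule diassociative_quot)
  obtain fl fr where [simp]: "c = (fl, fr)" by fastforce
  have *: "(fl, fr) \<in> cocycles F Q" using assms by simp
  show ?thesis
    using * by (simp add: Q.cocycles_iff cocycles_iff inflate_pair_def inflate_Bil
      lprod_coset[symmetric] rprod_coset[symmetric])
qed

lemma inflate_hom: "inflate_pair \<in> module_hom F (cocycle_space F Q) (cocycle_space F L)"
proof -
  interpret Q: diassociative_algebra F Q by (rule diassociative_quot)
  have [simp]: "inflate L Z (f \<oplus>\<^bsub>Bil F Q Q\<^esub> g) = inflate L Z f \<oplus>\<^bsub>Bil F L L\<^esub> inflate L Z g" for f g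
    by (rule Bil_eqI[of _ L L]) (simp_all add: inflate_extensional Bil_add)
  have [simp]: "inflate L Z (a \<odot>\<^bsub>Bil F Q Q\<^esub> f) = a \<odot>\<^bsub>Bil F L L\<^esub> inflate L Z f" for a f
    by (rule Bil_eqI[of _ L L]) (simp_all add: inflate_extensional Bil_smult)
  show ?thesis
    unfolding module_hom_def cocycle_space_simps Q.cocycle_space_simps
    using inflate_cocycle
    by (auto simp: inflate_pair_def cocycle_space_simps Q.cocycle_space_simps)
qed

text \<open>Inflating the coboundary of \<open>e\<close> gives the coboundary of \<open>e\<close>
  composed with the projection.\<close>

lemma inflate_coboundary:
  assumes "c \<in> coboundaries F Q"
  shows "inflate_pair c \<in> coboundaries F L"
proof -
  interpret Q: diassociative_algebra F Q by (rule diassociative_quot)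
  obtain e where e: "e \<in> linear_forms F Q" and c: "c = Q.coboundary e"
    using assms by (auto simp: Q.coboundaries_eq)
  have "(\<lambda>x. e (coset x)) \<in> linear_forms F L"
    using e by (auto simp: linear_forms_def Pi_iff quot_dialgebra_simps(2,3)[symmetric])
  moreover have "inflate_pair c = coboundary (\<lambda>x. e (coset x))"
    unfolding c inflate_pair_def coboundary_def Q.coboundary_def
    by (auto simp: inflate_def lprod_coset rprod_coset)
  ultimately show ?thesis by (simp add: coboundaries_eq)
qed

section \<open>Inflation on cohomology classes\<close>

lemma Inf_map_eq:
  "Inf_map F L Z =
    (\<lambda>X. the_elem ((\<lambda>c. coboundaries F L +>\<^bsub>cocycle_space F L\<^esub> inflate_pair c) ` X))"
  by (simp add: fun_eq_iff Inf_map_def inflate_pair_def case_prod_unfold)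

lemma inflate_coset_hom:
  "(\<lambda>c. coboundaries F L +>\<^bsub>cocycle_space F L\<^esub> inflate_pair c)
    \<in> module_hom F (cocycle_space F Q) (H2 F L)"
  unfolding H2_def
  by (rule module_hom_compose[OF inflate_hom quotient_space.coset_hom[OF H2_quotient_space]])

text \<open>The vanishing condition under which inflation followed by the projection to
  \<open>H2 F L\<close> factors through \<open>H2 F Q\<close>.\<close>

lemma inflate_coset_coboundary:
  assumes "c \<in> coboundaries F Q"
  shows "coboundaries F L +>\<^bsub>cocycle_space F L\<^esub> inflate_pair c = \<zero>\<^bsub>H2 F L\<^esub>"
proof -
  interpret H: quotient_space F "cocycle_space F L" "coboundaries F L" by (rule H2_quotient_space)
  show ?thesis
    using C.M.a_coset_join2[OF _ H.N.a_subgroup] inflate_coboundary[OF assms]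
    by (simp add: H2_def quot_space_def)
qed

lemma Inf_linear: "linear_map F (H2 F Q) (H2 F L) (Inf_map F L Z)"
proof -
  interpret Q: diassociative_algebra F Q by (rule diassociative_quot)
  show ?thesis
    unfolding Inf_map_eq H2_def[of F Q]
    by (rule quotient_space.induced_linear[OF Q.H2_quotient_space vectorspace_H2
          inflate_coset_hom inflate_coset_coboundary])
qed

lemma Inf_map_coset:
  assumes "c \<in> cocycles F Q"
  shows "Inf_map F L Z (coboundaries F Q +>\<^bsub>cocycle_space F Q\<^esub> c) =
    coboundaries F L +>\<^bsub>cocycle_space F L\<^esub> inflate_pair c"
proof -
  interpret Q: diassociative_algebra F Q by (rule diassociative_quot)
  show ?thesis
    unfolding Inf_map_eq
    by (rule quotient_space.induced_coset[OF Q.H2_quotient_space vectorspace_H2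
          inflate_coset_hom inflate_coset_coboundary])
      (use assms in \<open>simp_all add: Q.cocycle_space_simps\<close>)
qed

section \<open>Descent of forms and cocycles to the quotient algebra\<close>

lemma Bil_descends:
  assumes f: "f \<in> carrier (Bil F L L)"
    and 0: "\<And>x z. \<lbrakk>x \<in> carrier L; z \<in> Z\<rbrakk> \<Longrightarrow> f (x, z) = \<zero>\<^bsub>F\<^esub> \<and> f (z, x) = \<zero>\<^bsub>F\<^esub>"
  obtains g where "g \<in> carrier (Bil F Q Q)" "inflate L Z g = f"
proof -
  define g where "g = (\<lambda>(X, Y)\<in>carrier Q \<times> carrier Q. the_elem (f ` (X \<times> Y)))"
  have g [simp]: "g (coset x, coset y) = f (x, y)" if "x \<in> carrier L" "y \<in> carrier L" for x y
  proof -
    \<comment> \<open>Of the four terms of \<open>f (m + x, n + y)\<close>, the three other than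
      \<open>f (x, y)\<close> have an argument in \<open>Z\<close> and vanish by assumption. So
      \<open>f\<close> is constant on the product of the two cosets.\<close>
    have "f ` (coset x \<times> coset y) = {f (x, y)}"
      using that 0 Bil_closed[OF f]
      by (intro Z.image_coset2) (simp_all add: Bil_add_left[OF f] Bil_add_right[OF f])
    then show ?thesis using that by (simp add: g_def)
  qed
  have "g \<in> carrier (Bil F Q Q)"
    unfolding Bil_iff
    using Bil_closed[OF f] Bil_add_left[OF f] Bil_add_right[OF f]
      Bil_smult_left[OF f] Bil_smult_right[OF f]
    by (auto simp: quot_dialgebra_simps) (simp add: g_def quot_dialgebra_simps)
  moreover have "inflate L Z g = f"
    by (rule Bil_eqI[of _ L L]) (simp_all add: inflate_extensional Bil_extensional[OF f])
  ultimately show ?thesis by (rule that)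
qed

lemma cocycle_descends:
  assumes c: "(fl, fr) \<in> cocycles F L"
    and 0: "\<And>f x z. \<lbrakk>f \<in> {fl, fr}; x \<in> carrier L; z \<in> Z\<rbrakk> \<Longrightarrow> f (x, z) = \<zero>\<^bsub>F\<^esub> \<and> f (z, x) = \<zero>\<^bsub>F\<^esub>"
  obtains c' where "c' \<in> cocycles F Q" "inflate_pair c' = (fl, fr)"
proof -
  interpret Q: diassociative_algebra F Q by (rule diassociative_quot)
  obtain gl where gl: "gl \<in> carrier (Bil F Q Q)" "inflate L Z gl = fl"
    using Bil_descends[of fl] c 0 by (auto simp: cocycles_iff)
  obtain gr where gr: "gr \<in> carrier (Bil F Q Q)" "inflate L Z gr = fr"
    using Bil_descends[of fr] c 0 by (auto simp: cocycles_iff)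
  have "gl (coset x, coset y) = fl (x, y)" "gr (coset x, coset y) = fr (x, y)"
    if "x \<in> carrier L" "y \<in> carrier L" for x y
    using that gl(2) gr(2) by auto
  \<comment> \<open>Every element of \<open>Q\<close> is a coset, so each identity for
    \<open>(gl, gr)\<close> is the identity for \<open>(fl, fr)\<close> at representatives.\<close>
  then have "(gl, gr) \<in> cocycles F Q"
    using c gl(1) gr(1) unfolding Q.cocycles_iff cocycles_iff
    by (simp add: quot_dialgebra_simps(1) lprod_coset rprod_coset)
  moreover have "inflate_pair (gl, gr) = (fl, fr)"
    by (simp add: inflate_pair_def gl gr)
  ultimately show ?thesis by (rule that)
qed

subsection \<open>The restriction map\<close>

abbreviation D where "D \<equiv> derived F L"

abbreviation V where "V \<equiv> L\<lparr>carrier := Z\<rparr>"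

lemma subspace_derived: "subspace F D L"
  unfolding derived_def by (rule span_is_subspace) auto

sublocale D: quotient_space F L D
  by (intro quotient_space.intro quotient_space_axioms.intro vectorspace_L subspace_derived)

text \<open>Such a form induces forms on \<open>L/L' \<times> Z\<close> and on \<open>Z \<times> L/L'\<close>.\<close>

definition factors where
  "factors f \<longleftrightarrow> f \<in> carrier (Bil F L L) \<and> (\<forall>d\<in>D. \<forall>z\<in>Z. f (d, z) = \<zero>\<^bsub>F\<^esub> \<and> f (z, d) = \<zero>\<^bsub>F\<^esub>)"

lemma cocycle_factors:
  assumes c: "(fl, fr) \<in> cocycles F L"
  shows "factors fl" "factors fr"
proof -
  have fl: "fl \<in> carrier (Bil F L L)" and fr: "fr \<in> carrier (Bil F L L)"
    using c by (simp_all add: cocycles_iff)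
  \<comment> \<open>The elements that both forms annihilate against \<open>Z\<close>, on either
    side. As this is a subspace, it contains the span \<open>D\<close> once it contains all
    products.\<close>
  let ?K = "{d \<in> carrier L. \<forall>z\<in>Z. fl (d, z) = \<zero>\<^bsub>F\<^esub> \<and> fl (z, d) = \<zero>\<^bsub>F\<^esub> \<and>
    fr (d, z) = \<zero>\<^bsub>F\<^esub> \<and> fr (z, d) = \<zero>\<^bsub>F\<^esub>}"
  have "subspace F ?K L"
    by (rule subspaceI)
      (auto simp: Bil_zero_arg[OF fl] Bil_zero_arg[OF fr]
        Bil_add_left[OF fl] Bil_add_left[OF fr] Bil_add_right[OF fl] Bil_add_right[OF fr]
        Bil_smult_left[OF fl] Bil_smult_left[OF fr] Bil_smult_right[OF fl] Bil_smult_right[OF fr])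
  moreover have "x \<stileturn>\<^bsub>L\<^esub> y \<in> ?K \<and> x \<turnstile>\<^bsub>L\<^esub> y \<in> ?K" if xy: "x \<in> carrier L" "y \<in> carrier L" for x y
  proof -
    have "fl (x \<stileturn>\<^bsub>L\<^esub> y, z) = \<zero>\<^bsub>F\<^esub> \<and> fl (z, x \<stileturn>\<^bsub>L\<^esub> y) = \<zero>\<^bsub>F\<^esub> \<and>
        fr (x \<stileturn>\<^bsub>L\<^esub> y, z) = \<zero>\<^bsub>F\<^esub> \<and> fr (z, x \<stileturn>\<^bsub>L\<^esub> y) = \<zero>\<^bsub>F\<^esub> \<and>
        fl (x \<turnstile>\<^bsub>L\<^esub> y, z) = \<zero>\<^bsub>F\<^esub> \<and> fl (z, x \<turnstile>\<^bsub>L\<^esub> y) = \<zero>\<^bsub>F\<^esub> \<and>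
        fr (x \<turnstile>\<^bsub>L\<^esub> y, z) = \<zero>\<^bsub>F\<^esub> \<and> fr (z, x \<turnstile>\<^bsub>L\<^esub> y) = \<zero>\<^bsub>F\<^esub>" if z: "z \<in> Z" for z
    proof -
      have *: "fl (i, j \<stileturn>\<^bsub>L\<^esub> k) = fl (i, j \<turnstile>\<^bsub>L\<^esub> k)" "fl (i \<turnstile>\<^bsub>L\<^esub> j, k) = fr (i, j \<stileturn>\<^bsub>L\<^esub> k)"
        "fr (i \<stileturn>\<^bsub>L\<^esub> j, k) = fr (i \<turnstile>\<^bsub>L\<^esub> j, k)" "fl (i, j \<stileturn>\<^bsub>L\<^esub> k) = fl (i \<stileturn>\<^bsub>L\<^esub> j, k)"
        "fr (i, j \<turnstile>\<^bsub>L\<^esub> k) = fr (i \<turnstile>\<^bsub>L\<^esub> j, k)"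
        if "i \<in> carrier L" "j \<in> carrier L" "k \<in> carrier L" for i j k
        using c that by (simp_all add: cocycles_iff)
      have zL: "z \<in> carrier L" using z by simp
      note 0 = central_simps[OF z] Bil_zero_arg[OF fl] Bil_zero_arg[OF fr]
      \<comment> \<open>At \<open>(z, x, y)\<close> the identities treat \<open>z\<close> in the
        first slot, for instance \<open>fl (z, x \<stileturn> y) = fl (z \<stileturn> x, y)\<close>;
        at \<open>(x, y, z)\<close> they treat it in the second, for instance
        \<open>fl (x \<turnstile> y, z) = fr (x, y \<stileturn> z)\<close>. The product with
        \<open>z\<close> is zero by centrality.\<close>
      show ?thesis
        using *[OF zL xy] *[OF xy zL] xy zL by (simp add: 0)
    qed
    then show ?thesis using xy by simp
  qed
  ultimately have "D \<subseteq> ?K"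
    unfolding derived_def by (intro span_is_subset) (auto simp: subspace_def)
  then show "factors fl" "factors fr" using fl fr by (auto simp: factors_def)
qed

text \<open>Replacing \<open>x\<close> by \<open>d + x\<close> with \<open>d\<close> in
  \<open>D\<close> adds \<open>f (d, z) = 0\<close>, so the value does not depend on the
  representative.\<close>

lemma delta_left_apply:
  assumes "factors f" "x \<in> carrier L" "z \<in> Z"
  shows "delta_left F L Z f (D +>\<^bsub>L\<^esub> x, z) = f (x, z)"
proof -
  have f: "f \<in> carrier (Bil F L L)" using assms by (simp add: factors_def)
  have "(\<lambda>x. f (x, z)) ` (D +>\<^bsub>L\<^esub> x) = {f (x, z)}"
    using assms Bil_closed[OF f]
    by (intro D.image_coset) (simp_all add: Bil_add_left[OF f] factors_def)
  then show ?thesis using assms by (simp add: delta_left_def D.quot_carrier)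
qed

lemma delta_right_apply:
  assumes "factors f" "x \<in> carrier L" "z \<in> Z"
  shows "delta_right F L Z f (z, D +>\<^bsub>L\<^esub> x) = f (z, x)"
proof -
  have f: "f \<in> carrier (Bil F L L)" using assms by (simp add: factors_def)
  have "(\<lambda>x. f (z, x)) ` (D +>\<^bsub>L\<^esub> x) = {f (z, x)}"
    using assms Bil_closed[OF f]
    by (intro D.image_coset) (simp_all add: Bil_add_right[OF f] factors_def)
  then show ?thesis using assms by (simp add: delta_right_def D.quot_carrier)
qed

abbreviation LD where "LD \<equiv> quot_space L D"

lemma delta_extensional:
  "delta_left F L Z f \<in> extensional (carrier LD \<times> carrier V)"
  "delta_right F L Z f \<in> extensional (carrier V \<times> carrier LD)"
  by (simp_all add: delta_left_def delta_right_def)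

lemma Bil_LD_eqI:
  assumes "f \<in> extensional (carrier LD \<times> carrier V)" "g \<in> extensional (carrier LD \<times> carrier V)"
    and "\<And>x z. \<lbrakk>x \<in> carrier L; z \<in> Z\<rbrakk> \<Longrightarrow> f (D +>\<^bsub>L\<^esub> x, z) = g (D +>\<^bsub>L\<^esub> x, z)"
  shows "f = g"
  using assms by (intro Bil_eqI[of _ LD V]) (auto simp: D.quot_carrier)

lemma Bil_DL_eqI:
  assumes "f \<in> extensional (carrier V \<times> carrier LD)" "g \<in> extensional (carrier V \<times> carrier LD)"
    and "\<And>x z. \<lbrakk>x \<in> carrier L; z \<in> Z\<rbrakk> \<Longrightarrow> f (z, D +>\<^bsub>L\<^esub> x) = g (z, D +>\<^bsub>L\<^esub> x)"
  shows "f = g"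
  using assms by (intro Bil_eqI[of _ V LD]) (auto simp: D.quot_carrier)

text \<open>Evaluated at representatives, the bilinearity conditions are those of \<open>f\<close>,
  with one argument confined to the subspace \<open>Z\<close>.\<close>

lemma delta_Bil:
  assumes f: "factors f"
  shows "delta_left F L Z f \<in> carrier (Bil F LD V)" "delta_right F L Z f \<in> carrier (Bil F V LD)"
proof -
  have f': "f \<in> carrier (Bil F L L)" using f by (simp add: factors_def)
  note simps = delta_extensional[simplified] D.quot_carrier D.quot_add D.quot_smult
    delta_left_apply[OF f] delta_right_apply[OF f] Z.N_smult
    Bil_closed[OF f'] Bil_add_left[OF f'] Bil_add_right[OF f']
    Bil_smult_left[OF f'] Bil_smult_right[OF f']
  show "delta_left F L Z f \<in> carrier (Bil F LD V)"
    unfolding Bil_iff using delta_extensional(1) by (auto simp: simps)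
  show "delta_right F L Z f \<in> carrier (Bil F V LD)"
    unfolding Bil_iff using delta_extensional(2) by (auto simp: simps)
qed

text \<open>That the sum factors is assumed here; for cocycles it follows from
  \<open>cocycle_factors\<close>, because a sum of cocycles is a cocycle.\<close>

lemma delta_add:
  assumes "factors f" "factors g" "factors (f \<oplus>\<^bsub>Bil F L L\<^esub> g)"
  shows "delta_left F L Z (f \<oplus>\<^bsub>Bil F L L\<^esub> g) =
      delta_left F L Z f \<oplus>\<^bsub>Bil F LD V\<^esub> delta_left F L Z g"
    "delta_right F L Z (f \<oplus>\<^bsub>Bil F L L\<^esub> g) =
      delta_right F L Z f \<oplus>\<^bsub>Bil F V LD\<^esub> delta_right F L Z g"
proof -
  show "delta_left F L Z (f \<oplus>\<^bsub>Bil F L L\<^esub> g) =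
      delta_left F L Z f \<oplus>\<^bsub>Bil F LD V\<^esub> delta_left F L Z g"
    by (rule Bil_LD_eqI, rule delta_extensional)
      (use assms in \<open>simp_all add: Bil_add delta_left_apply[simplified Bil_add] D.quot_carrier\<close>)
  show "delta_right F L Z (f \<oplus>\<^bsub>Bil F L L\<^esub> g) =
      delta_right F L Z f \<oplus>\<^bsub>Bil F V LD\<^esub> delta_right F L Z g"
    by (rule Bil_DL_eqI, rule delta_extensional)
      (use assms in \<open>simp_all add: Bil_add delta_right_apply[simplified Bil_add] D.quot_carrier\<close>)
qed

lemma delta_smult:
  assumes "factors f" "factors (a \<odot>\<^bsub>Bil F L L\<^esub> f)"
  shows "delta_left F L Z (a \<odot>\<^bsub>Bil F L L\<^esub> f) = a \<odot>\<^bsub>Bil F LD V\<^esub> delta_left F L Z f"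
    "delta_right F L Z (a \<odot>\<^bsub>Bil F L L\<^esub> f) = a \<odot>\<^bsub>Bil F V LD\<^esub> delta_right F L Z f"
proof -
  show "delta_left F L Z (a \<odot>\<^bsub>Bil F L L\<^esub> f) = a \<odot>\<^bsub>Bil F LD V\<^esub> delta_left F L Z f"
    by (rule Bil_LD_eqI, rule delta_extensional)
      (use assms in \<open>simp_all add: Bil_smult delta_left_apply D.quot_carrier\<close>)
  show "delta_right F L Z (a \<odot>\<^bsub>Bil F L L\<^esub> f) = a \<odot>\<^bsub>Bil F V LD\<^esub> delta_right F L Z f"
    by (rule Bil_DL_eqI, rule delta_extensional)
      (use assms in \<open>simp_all add: Bil_smult delta_right_apply D.quot_carrier\<close>)
qed

text \<open>Every element of \<open>LD\<close> is the coset of some \<open>x\<close>, so the induced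
  forms vanish exactly when \<open>f\<close> vanishes on all representatives. This identifies the
  kernel of the restriction map.\<close>

lemma delta_eq_zero_iff:
  assumes "factors f"
  shows "delta_left F L Z f = \<zero>\<^bsub>Bil F LD V\<^esub> \<longleftrightarrow> (\<forall>x\<in>carrier L. \<forall>z\<in>Z. f (x, z) = \<zero>\<^bsub>F\<^esub>)"
    "delta_right F L Z f = \<zero>\<^bsub>Bil F V LD\<^esub> \<longleftrightarrow> (\<forall>x\<in>carrier L. \<forall>z\<in>Z. f (z, x) = \<zero>\<^bsub>F\<^esub>)"
proof -
  show "delta_left F L Z f = \<zero>\<^bsub>Bil F LD V\<^esub> \<longleftrightarrow> (\<forall>x\<in>carrier L. \<forall>z\<in>Z. f (x, z) = \<zero>\<^bsub>F\<^esub>)"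
  proof
    assume *: "delta_left F L Z f = \<zero>\<^bsub>Bil F LD V\<^esub>"
    show "\<forall>x\<in>carrier L. \<forall>z\<in>Z. f (x, z) = \<zero>\<^bsub>F\<^esub>"
      by (simp add: delta_left_apply[OF assms, symmetric] * Bil_zero D.quot_carrier)
  next
    assume "\<forall>x\<in>carrier L. \<forall>z\<in>Z. f (x, z) = \<zero>\<^bsub>F\<^esub>"
    then show "delta_left F L Z f = \<zero>\<^bsub>Bil F LD V\<^esub>"
      by (intro Bil_LD_eqI[OF delta_extensional(1)])
        (simp_all add: delta_left_apply[OF assms] Bil_zero D.quot_carrier)
  qed
  show "delta_right F L Z f = \<zero>\<^bsub>Bil F V LD\<^esub> \<longleftrightarrow> (\<forall>x\<in>carrier L. \<forall>z\<in>Z. f (z, x) = \<zero>\<^bsub>F\<^esub>)"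
  proof
    assume *: "delta_right F L Z f = \<zero>\<^bsub>Bil F V LD\<^esub>"
    show "\<forall>x\<in>carrier L. \<forall>z\<in>Z. f (z, x) = \<zero>\<^bsub>F\<^esub>"
      by (simp add: delta_right_apply[OF assms, symmetric] * Bil_zero D.quot_carrier)
  next
    assume "\<forall>x\<in>carrier L. \<forall>z\<in>Z. f (z, x) = \<zero>\<^bsub>F\<^esub>"
    then show "delta_right F L Z f = \<zero>\<^bsub>Bil F V LD\<^esub>"
      by (intro Bil_DL_eqI[OF delta_extensional(2)])
        (simp_all add: delta_right_apply[OF assms] Bil_zero D.quot_carrier)
  qed
qed

section \<open>Restriction of cocycles and of cohomology classes\<close>

definition delta_pair where
  "delta_pair = (\<lambda>(fl, fr). ((delta_left F L Z fl, delta_right F L Z fl),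
    (delta_left F L Z fr, delta_right F L Z fr)))"

lemma delta_map_eq: "delta_map F L Z = (\<lambda>X. the_elem (delta_pair ` X))"
  by (simp add: delta_map_def delta_pair_def fun_eq_iff)

lemma vectorspace_delta_target: "vectorspace F (delta_target F L Z)"
proof -
  have V: "vectorspace F V" by (rule subspace_is_vs[OF Z.subspace])
  show ?thesis
    unfolding delta_target_def Let_def
    by (intro direct_sum_is_vs vectorspace_Bil D.vectorspace_quot V)
qed

lemma delta_target_simps:
  "carrier (delta_target F L Z) =
    (carrier (Bil F LD V) \<times> carrier (Bil F V LD)) \<times> (carrier (Bil F LD V) \<times> carrier (Bil F V LD))"
  "\<zero>\<^bsub>delta_target F L Z\<^esub> =
    ((\<zero>\<^bsub>Bil F LD V\<^esub>, \<zero>\<^bsub>Bil F V LD\<^esub>), (\<zero>\<^bsub>Bil F LD V\<^esub>, \<zero>\<^bsub>Bil F V LD\<^esub>))"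
  "((p, q), (r, s)) \<oplus>\<^bsub>delta_target F L Z\<^esub> ((p', q'), (r', s')) =
    ((p \<oplus>\<^bsub>Bil F LD V\<^esub> p', q \<oplus>\<^bsub>Bil F V LD\<^esub> q'), (r \<oplus>\<^bsub>Bil F LD V\<^esub> r', s \<oplus>\<^bsub>Bil F V LD\<^esub> s'))"
  "a \<odot>\<^bsub>delta_target F L Z\<^esub> ((p, q), (r, s)) =
    ((a \<odot>\<^bsub>Bil F LD V\<^esub> p, a \<odot>\<^bsub>Bil F V LD\<^esub> q), (a \<odot>\<^bsub>Bil F LD V\<^esub> r, a \<odot>\<^bsub>Bil F V LD\<^esub> s))"
  by (simp_all add: delta_target_def Let_def direct_sum_def)

lemma delta_hom: "delta_pair \<in> module_hom F (cocycle_space F L) (delta_target F L Z)"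
  unfolding module_hom_def mem_Collect_eq
proof (intro conjI allI impI)
  show "delta_pair \<in> carrier (cocycle_space F L) \<rightarrow> carrier (delta_target F L Z)"
    using cocycle_factors delta_Bil
    by (auto simp: cocycle_space_simps delta_target_simps delta_pair_def)
next
  fix c c' assume *: "c \<in> carrier (cocycle_space F L) \<and> c' \<in> carrier (cocycle_space F L)"
  obtain fl fr gl gr where [simp]: "c = (fl, fr)" "c' = (gl, gr)" by fastforce
  \<comment> \<open>The sum is again a cocycle, which supplies \<open>factors\<close> for its two
    components.\<close>
  have "c \<oplus>\<^bsub>cocycle_space F L\<^esub> c' \<in> carrier (cocycle_space F L)"
    using * by (blast intro: C.M.a_closed)
  then have "factors (fl \<oplus>\<^bsub>Bil F L L\<^esub> gl)" "factors (fr \<oplus>\<^bsub>Bil F L L\<^esub> gr)"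
    using cocycle_factors by (simp_all add: cocycle_space_simps)
  moreover have "factors fl" "factors fr" "factors gl" "factors gr"
    using * cocycle_factors by (auto simp: cocycle_space_simps)
  ultimately show "delta_pair (c \<oplus>\<^bsub>cocycle_space F L\<^esub> c') =
      delta_pair c \<oplus>\<^bsub>delta_target F L Z\<^esub> delta_pair c'"
    by (simp add: cocycle_space_simps delta_pair_def delta_target_simps delta_add)
next
  fix a c assume *: "a \<in> carrier F \<and> c \<in> carrier (cocycle_space F L)"
  obtain fl fr where [simp]: "c = (fl, fr)" by fastforce
  have "a \<odot>\<^bsub>cocycle_space F L\<^esub> c \<in> carrier (cocycle_space F L)"
    using * by (blast intro: C.smult_closed)
  then have "factors (a \<odot>\<^bsub>Bil F L L\<^esub> fl)" "factors (a \<odot>\<^bsub>Bil F L L\<^esub> fr)"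
    using cocycle_factors by (simp_all add: cocycle_space_simps)
  moreover have "factors fl" "factors fr"
    using * cocycle_factors by (auto simp: cocycle_space_simps)
  ultimately show "delta_pair (a \<odot>\<^bsub>cocycle_space F L\<^esub> c) = a \<odot>\<^bsub>delta_target F L Z\<^esub> delta_pair c"
    by (simp add: cocycle_space_simps delta_pair_def delta_target_simps delta_smult)
qed

lemma delta_pair_eq_zero_iff:
  assumes "(fl, fr) \<in> cocycles F L"
  shows "delta_pair (fl, fr) = \<zero>\<^bsub>delta_target F L Z\<^esub> \<longleftrightarrow>
    (\<forall>f\<in>{fl, fr}. \<forall>x\<in>carrier L. \<forall>z\<in>Z. f (x, z) = \<zero>\<^bsub>F\<^esub> \<and> f (z, x) = \<zero>\<^bsub>F\<^esub>)"
  using cocycle_factors[OF assms]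
  by (auto simp: delta_pair_def delta_target_simps delta_eq_zero_iff)

text \<open>On a pair with one argument in \<open>Z\<close> the coboundary is \<open>-e\<close> of a
  product with a central element, that is, \<open>-e 0 = 0\<close>.\<close>

lemma delta_coboundary:
  assumes "c \<in> coboundaries F L"
  shows "delta_pair c = \<zero>\<^bsub>delta_target F L Z\<^esub>"
proof -
  obtain e where e: "e \<in> linear_forms F L" and c: "c = coboundary e"
    using assms by (auto simp: coboundaries_eq)
  \<comment> \<open>Homogeneity at the scalar \<open>0\<close> yields
    \<open>e 0 = 0\<close>.\<close>
  have "e (\<zero>\<^bsub>F\<^esub> \<odot>\<^bsub>L\<^esub> \<zero>\<^bsub>L\<^esub>) = \<zero>\<^bsub>F\<^esub> \<otimes>\<^bsub>F\<^esub> e \<zero>\<^bsub>L\<^esub>" "e \<zero>\<^bsub>L\<^esub> \<in> carrier F"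
    using e unfolding linear_forms_def by (blast, auto)
  then have "e \<zero>\<^bsub>L\<^esub> = \<zero>\<^bsub>F\<^esub>" by simp
  then show ?thesis
    using coboundary_cocycle[OF e] unfolding c coboundary_def
    by (subst delta_pair_eq_zero_iff) (simp_all add: central_simps)
qed

lemma delta_linear: "linear_map F (H2 F L) (delta_target F L Z) (delta_map F L Z)"
  unfolding delta_map_eq H2_def
  by (rule quotient_space.induced_linear[OF H2_quotient_space vectorspace_delta_target
        delta_hom delta_coboundary])

lemma delta_map_coset:
  assumes "c \<in> cocycles F L"
  shows "delta_map F L Z (coboundaries F L +>\<^bsub>cocycle_space F L\<^esub> c) = delta_pair c"
  unfolding delta_map_eq
  by (rule quotient_space.induced_coset[OF H2_quotient_space vectorspace_delta_target
        delta_hom delta_coboundary])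
    (use assms in \<open>simp_all add: cocycle_space_simps\<close>)

section \<open>Exactness at the cohomology of \<open>L\<close>\<close>

lemma delta_inflate:
  assumes "c \<in> cocycles F Q"
  shows "delta_pair (inflate_pair c) = \<zero>\<^bsub>delta_target F L Z\<^esub>"
proof -
  interpret Q: diassociative_algebra F Q by (rule diassociative_quot)
  obtain fl fr where [simp]: "c = (fl, fr)" by fastforce
  have f: "fl \<in> carrier (Bil F Q Q)" "fr \<in> carrier (Bil F Q Q)"
    using assms by (simp_all add: Q.cocycles_iff)
  \<comment> \<open>Elements of \<open>Z\<close> become zero in the quotient, so an inflated form
    takes the same value at \<open>z\<close> as at zero, and this value is zero by
    bilinearity.\<close>
  have Z0: "coset z = coset \<zero>\<^bsub>L\<^esub>" if "z \<in> Z" for z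
    using Z.coset_add_absorb[OF that, of "\<zero>\<^bsub>L\<^esub>"] that by simp
  have "f (coset x, coset z) = \<zero>\<^bsub>F\<^esub> \<and> f (coset z, coset x) = \<zero>\<^bsub>F\<^esub>"
    if "f \<in> {fl, fr}" "x \<in> carrier L" "z \<in> Z" for f x z
  proof -
    have "inflate L Z f \<in> carrier (Bil F L L)" using that f inflate_Bil by auto
    from Bil_zero_arg[OF this that(2)] show ?thesis
      using that by (simp add: Z0[OF that(3)])
  qed
  then show ?thesis
    using inflate_cocycle[OF assms]
    by (auto simp: inflate_pair_def delta_pair_eq_zero_iff)
qed

lemma exact:
  "exact_sequence F (H2 F Q) (Inf_map F L Z) (H2 F L) (delta_map F L Z) (delta_target F L Z)"
proof -
  interpret Q: diassociative_algebra F Q by (rule diassociative_quot)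
  interpret I: linear_map F "H2 F Q" "H2 F L" "Inf_map F L Z" by (rule Inf_linear)
  interpret d: linear_map F "H2 F L" "delta_target F L Z" "delta_map F L Z" by (rule delta_linear)
  have "I.im = d.ker"
  proof
    \<comment> \<open>Every class is represented by a cocycle, and on representatives the composite
      is \<open>delta_pair\<close> after \<open>inflate_pair\<close>.\<close>
    show "I.im \<subseteq> d.ker"
      using inflate_cocycle
      by (auto simp: I.im_def d.ker_def Q.H2_carrier H2_carrier Inf_map_coset delta_map_coset
          delta_inflate)
    show "d.ker \<subseteq> I.im"
    proof
      fix X assume X: "X \<in> d.ker"
      then obtain fl fr where c: "(fl, fr) \<in> cocycles F L"
        and X_eq: "X = coboundaries F L +>\<^bsub>cocycle_space F L\<^esub> (fl, fr)"
        by (auto simp: d.ker_def H2_carrier)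
      \<comment> \<open>The chosen representative itself restricts to zero, so it descends to a
        cocycle \<open>c'\<close> on \<open>Q\<close>. Its inflation is \<open>(fl, fr)\<close>
        exactly, hence the class of \<open>c'\<close> is a preimage of \<open>X\<close>.\<close>
      have "delta_pair (fl, fr) = \<zero>\<^bsub>delta_target F L Z\<^esub>"
        using X by (simp add: d.ker_def X_eq delta_map_coset c)
      then obtain c' where "c' \<in> cocycles F Q" "inflate_pair c' = (fl, fr)"
        using cocycle_descends[OF c] unfolding delta_pair_eq_zero_iff[OF c] by metis
      then show "X \<in> I.im"
        unfolding I.im_def Q.H2_carrier image_image
        by (auto simp: X_eq Inf_map_coset intro!: image_eqI[where x = c'])
    qed
  qed
  then show ?thesis
    using Inf_linear delta_linear by (simp add: exact_sequence_def)
qed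

end

theorem theorem4p1:
  fixes F :: "('a, 'c) ring_scheme"
    and L :: "('a, 'b, 'd) dialgebra_scheme"
    and Z :: "'b set"
  assumes "diassociative_algebra F L"
    and "central_ideal F Z L"
  shows "exact_sequence F
    (H2 F (quot_dialgebra L Z)) (Inf_map F L Z) (H2 F L) (delta_map F L Z) (delta_target F L Z)"
proof -
  have "central_extension F L Z"
    using assms
    by (simp add: central_extension_def central_extension_axioms_def dialgebra_quotient_def
        dialgebra_quotient_axioms_def central_ideal_def)
  then show ?thesis by (rule central_extension.exact)
qed

end
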